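(* A continuous transformation will conserve the uncertainty of a distribution with small support (that is, of all such distributions) if and only if the Jacobian is unitary, i.e. the Jacobian determinant $|J|$ is equal to $1$ everywhere. Here the uncertainty is characterized by the determinant of the covariance matrix, and small means that the evolution can be considered approximately linear over the support of the distribution.
   Context: The transformation is written $y^j=y^j(x^i)$, where $x^i$ and $y^j$ are the variables before and after it, and $J$, with entries $J^j_i=\frac{\partial y^j}{\partial x^i}$, is its Jacobian matrix, with determinant $|J|$. The uncertainty of a distribution over the variables $x^i$ is $|\Sigma|$, the determinant of the covariance matrix $\Sigma^{ij}=\mathrm{cov}(x^i,x^j)$; it is conserved if the determinant of $\mathrm{cov}(y^i,y^j)$ equals the determinant of $\mathrm{cov}(x^i,x^j)$. For a distribution with small support the transformation is treated as linear over the support, $y^j=J^j_i x^i+B^j$ with $B^j$ constant (sum over repeated indices). The term continuous transformation is used in the sense of a continuous evolution, for which the Jacobian determinant is positive (it cannot be a reflection). *)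

theory Defs
  imports "HOL-Probability.Probability"
begin

definition distribution :: "(real^'n) measure \<Rightarrow> bool" where
  "distribution M \<longleftrightarrow>
     prob_space M \<and> sets M = sets borel \<and> integrable M (\<lambda>x. (norm x)\<^sup>2)"
  \<comment> \<open>finite second moments, so that the covariances below are genuine expectations\<close>

definition covariance :: "'a measure \<Rightarrow> ('a \<Rightarrow> real) \<Rightarrow> ('a \<Rightarrow> real) \<Rightarrow> real" where
  "covariance M X Y =
     (LINT w|M. (X w - (LINT u|M. X u)) * (Y w - (LINT u|M. Y u)))"

definition covariance_matrix :: "'a measure \<Rightarrow> ('a \<Rightarrow> real^'n) \<Rightarrow> real^'n^'n" where
  "covariance_matrix M X = (\<chi> i j. covariance M (\<lambda>w. X w $ i) (\<lambda>w. X w $ j))"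

definition uncertainty :: "'a measure \<Rightarrow> ('a \<Rightarrow> real^'n) \<Rightarrow> real" where
  "uncertainty M X = det (covariance_matrix M X)"

text \<open>
  A continuous transformation is one arising from a continuous evolution; what this contributes is
  that the Jacobian determinant is positive, so that reflections are excluded. Only that property
  is required, so every such evolution is covered.
\<close>

definition continuous_transformation :: "(real^'n) set \<Rightarrow> (real^'n \<Rightarrow> real^'n) \<Rightarrow> bool" where
  "continuous_transformation D f \<longleftrightarrow>
     open D \<and> (\<forall>p\<in>D. f differentiable (at p) \<and> det (jacobian f (at p)) > 0)"

text \<open>The map \<open>y = J x + B\<close>, with \<open>J\<close> the Jacobian of \<open>f\<close> at \<open>p\<close> and the
  constant \<open>B\<close> chosen such that the map agrees with \<open>f\<close> at \<open>p\<close>.\<close>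

definition linearization :: "(real^'n \<Rightarrow> real^'n) \<Rightarrow> real^'n \<Rightarrow> real^'n \<Rightarrow> real^'n" where
  "linearization f p x = jacobian f (at p) *v x + (f p - jacobian f (at p) *v p)"

text \<open>
  A distribution is small (about \<open>p\<close>) if on its support \<open>f\<close> coincides with its linearization
  up to a relative error \<open>\<epsilon>\<close>. By differentiability, every distribution supported in a sufficiently
  small neighbourhood of \<open>p\<close> is of this kind; if \<open>f\<close> is affine, every distribution on \<open>D\<close> is.
\<close>

definition small_support ::
    "real \<Rightarrow> (real^'n) set \<Rightarrow> (real^'n \<Rightarrow> real^'n) \<Rightarrow> real^'n \<Rightarrow> (real^'n) measure \<Rightarrow> bool" where
  "small_support \<epsilon> D f p M \<longleftrightarrow>
     (AE x in M. x \<in> D \<and> norm (f x - linearization f p x) \<le> \<epsilon> * norm (x - p))"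

text \<open>Over a small support the transformation is treated as linear: the variables after the
  transformation are the linearized ones.\<close>

definition conserves_uncertainty ::
    "real \<Rightarrow> (real^'n) set \<Rightarrow> (real^'n \<Rightarrow> real^'n) \<Rightarrow> bool" where
  "conserves_uncertainty \<epsilon> D f \<longleftrightarrow>
     (\<forall>p\<in>D. \<forall>M. distribution M \<and> small_support \<epsilon> D f p M \<longrightarrow>
        uncertainty M (\<lambda>x. linearization f p x) = uncertainty M (\<lambda>x. x))"

end

(* The linearization at p acts on the covariance matrix by \<Sigma> \<mapsto> J \<Sigma> J\<^sup>T, hence on its determinant by
   multiplication with |J|\<^sup>2. So |J| = 1 is sufficient; for necessity, test on the uniform distribution
   on the points p \<pm> \<delta> e\<^sub>i, which is small about p for small \<delta> and whose covariance matrix is the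
   nonsingular \<delta>\<^sup>2/n times the identity, so that |J|\<^sup>2 = 1 and, by positivity, |J| = 1. *)
theory Submission
  imports Defs
begin

text \<open>Dominated by \<open>(norm x)\<^sup>2\<close>, the one moment that
  \<open>distribution\<close> controls; the first moments and the centered products below are
  derived from this.\<close>

lemma distribution_integrable_component_mult:
  fixes M :: "(real^'n) measure"
  assumes "distribution M"
  shows "integrable M (\<lambda>x. x $ i * x $ j)"
proof (rule Bochner_Integration.integrable_bound)
  show "integrable M (\<lambda>x. (norm x)\<^sup>2)"
    using assms by (simp add: distribution_def)
  have [measurable_cong]: "sets M = sets borel"
    using assms by (simp add: distribution_def)
  show "(\<lambda>x. x $ i * x $ j) \<in> borel_measurable M"
    by measurable
  show "AE x in M. norm (x $ i * x $ j) \<le> norm ((norm x)\<^sup>2)"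
    by (intro AE_I2) (auto simp: abs_mult power2_eq_square intro!: mult_mono component_le_norm_cart)
qed

lemma distribution_integrable_component:
  fixes M :: "(real^'n) measure"
  assumes "distribution M"
  shows "integrable M (\<lambda>x. x $ i)"
proof -
  interpret prob_space M
    using assms by (simp add: distribution_def)
  have [measurable_cong]: "sets M = sets borel"
    using assms by (simp add: distribution_def)
  show ?thesis
  proof (rule square_integrable_imp_integrable)
    show "(\<lambda>x. x $ i) \<in> borel_measurable M"
      by measurable
    show "integrable M (\<lambda>x. (x $ i)\<^sup>2)"
      using distribution_integrable_component_mult[OF assms, of i i] by (simp add: power2_eq_square)
  qed
qed

lemma distribution_integrable_centered_mult:
  fixes M :: "(real^'n) measure"
  assumes "distribution M"
  shows "integrable M (\<lambda>x. (x $ i - a) * (x $ j - b))"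
proof -
  interpret prob_space M
    using assms by (simp add: distribution_def)
  have "integrable M (\<lambda>x. x $ i * x $ j - a * x $ j - x $ i * b + a * b)"
    using distribution_integrable_component[OF assms] distribution_integrable_component_mult[OF assms]
    by auto
  then show ?thesis
    by (simp add: algebra_simps)
qed

text \<open>Centering cancels \<open>b\<close> and leaves a linear combination of the centered
  coordinates; covariance is bilinear in these, and integrability of their products lets the finite
  sums leave the integral.\<close>

lemma covariance_matrix_affine:
  fixes A :: "real^'n^'n" and M :: "(real^'n) measure"
  assumes M: "distribution M"
  shows "covariance_matrix M (\<lambda>x. A *v x + b)
    = A ** covariance_matrix M (\<lambda>x. x) ** transpose A"
proof -
  interpret prob_space M
    using M by (simp add: distribution_def)
  define m where "m k = (LINT x|M. x $ k)" for k
  note int = distribution_integrable_component[OF M]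
  have mean: "(LINT x|M. (A *v x + b) $ i) = (\<Sum>k\<in>UNIV. A $ i $ k * m k) + b $ i" for i
    using int by (simp add: matrix_vector_mult_def m_def prob_space)
  have centered: "(A *v x + b) $ i - (LINT u|M. (A *v u + b) $ i)
      = (\<Sum>k\<in>UNIV. A $ i $ k * (x $ k - m k))" for x i
    unfolding mean
    by (simp add: matrix_vector_mult_def right_diff_distrib sum_subtractf)
  \<comment> \<open>The nesting, with l outside and k inside, is that of the entries of the
    left-associated product \<open>A ** C ** transpose A\<close>. Since \<open>sum_product\<close>
    puts k outside, a \<open>sum.swap\<close> is required.\<close>
  have "covariance M (\<lambda>x. (A *v x + b) $ i) (\<lambda>x. (A *v x + b) $ j)
      = (\<Sum>l\<in>UNIV. (\<Sum>k\<in>UNIV. A $ i $ k * covariance M (\<lambda>x. x $ k) (\<lambda>x. x $ l)) * A $ j $ l)"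
    for i j
  proof -
    have "covariance M (\<lambda>x. (A *v x + b) $ i) (\<lambda>x. (A *v x + b) $ j)
        = (LINT x|M. (\<Sum>l\<in>UNIV. \<Sum>k\<in>UNIV.
             (A $ i $ k * A $ j $ l) * ((x $ k - m k) * (x $ l - m l))))"
      unfolding covariance_def centered sum_product
      by (subst sum.swap) (simp add: mult_ac)
    also have "\<dots> = (\<Sum>l\<in>UNIV. \<Sum>k\<in>UNIV.
        (A $ i $ k * A $ j $ l) * (LINT x|M. (x $ k - m k) * (x $ l - m l)))"
      using distribution_integrable_centered_mult[OF M]
      by (simp add: Bochner_Integration.integral_sum)
    finally show ?thesis
      by (simp add: covariance_def m_def sum_distrib_left sum_distrib_right mult_ac)
  qed
  then show ?thesis
    by (simp add: vec_eq_iff covariance_matrix_def matrix_matrix_mult_def transpose_def)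
qed

lemma uncertainty_linearization:
  assumes "distribution M"
  shows "uncertainty M (\<lambda>x. linearization f p x)
    = (det (jacobian f (at p)))\<^sup>2 * uncertainty M (\<lambda>x. x)"
  by (simp add: uncertainty_def linearization_def covariance_matrix_affine[OF assms] det_mul
      power2_eq_square)

text \<open>Indexing by axis and sign turns integrals into sums over a finite type, without asking
  whether the points are distinct.\<close>

definition cross_point :: "real^'n \<Rightarrow> real \<Rightarrow> 'n \<times> bool \<Rightarrow> real^'n" where
  "cross_point p \<delta> = (\<lambda>(i, b). p + (if b then \<delta> else - \<delta>) *\<^sub>R axis i 1)"

text \<open>The push-forward to \<open>borel\<close> replaces the discrete sigma-algebra of the pmf
  by the one that \<open>distribution\<close> demands.\<close>

definition cross_measure :: "real^'n \<Rightarrow> real \<Rightarrow> (real^'n) measure" where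
  "cross_measure p \<delta> = distr (measure_pmf (pmf_of_set UNIV)) borel (cross_point p \<delta>)"

lemma integral_cross_measure:
  fixes h :: "real^'n \<Rightarrow> real"
  assumes "h \<in> borel_measurable borel"
  shows "(LINT x|cross_measure p \<delta>. h x)
    = (\<Sum>i\<in>UNIV. h (p + \<delta> *\<^sub>R axis i 1) + h (p - \<delta> *\<^sub>R axis i 1)) / (2 * CARD('n))"
proof -
  have "(LINT x|cross_measure p \<delta>. h x)
      = (\<Sum>z\<in>(UNIV :: ('n \<times> bool) set). h (cross_point p \<delta> z)) / CARD('n \<times> bool)"
    using assms by (simp add: cross_measure_def integral_distr integral_pmf_of_set)
  also have "(\<Sum>z\<in>UNIV. h (cross_point p \<delta> z))
      = (\<Sum>i\<in>UNIV. h (p + \<delta> *\<^sub>R axis i 1) + h (p - \<delta> *\<^sub>R axis i 1))"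
    unfolding UNIV_Times_UNIV[symmetric] sum.cartesian_product'
    by (simp add: UNIV_bool cross_point_def add.commute)
  finally show ?thesis
    by (simp add: mult.commute)
qed

lemma distribution_cross_measure: "distribution (cross_measure p \<delta>)"
  unfolding distribution_def
proof (intro conjI)
  show "prob_space (cross_measure p \<delta>)"
    unfolding cross_measure_def by (intro measure_pmf.prob_space_distr) simp
  show "sets (cross_measure p \<delta>) = sets borel"
    by (simp add: cross_measure_def)
  show "integrable (cross_measure p \<delta>) (\<lambda>x. (norm x)\<^sup>2)"
    by (simp add: cross_measure_def integrable_distr_eq integrable_measure_pmf_finite)
qed

text \<open>Each point leaves the mean p along a single axis, so mixed products vanish. On the
  diagonal only the two points on axis i contribute, giving 2\<delta>^2 / (2n).\<close>

lemma covariance_matrix_cross_measure: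
  fixes p :: "real^'n"
  shows "covariance_matrix (cross_measure p \<delta>) (\<lambda>x. x) = mat (\<delta>\<^sup>2 / CARD('n))"
proof -
  have mean: "(LINT x|cross_measure p \<delta>. x $ i) = p $ i" for i
    by (simp add: integral_cross_measure)
  have "covariance (cross_measure p \<delta>) (\<lambda>x. x $ i) (\<lambda>x. x $ j)
      = (if i = j then \<delta>\<^sup>2 / CARD('n) else 0)" for i j :: 'n
  proof -
    \<comment> \<open>The two equal summands come from the opposite points, whose signs cancel in
      the product. The right side is put in the shape that \<open>sum.delta\<close>
      evaluates.\<close>
    have "(\<Sum>k\<in>UNIV. \<delta> * axis k 1 $ i * (\<delta> * axis k 1 $ j) + \<delta> * axis k 1 $ i * (\<delta> * axis k 1 $ j))
        = (\<Sum>k\<in>UNIV. if k = i then (if i = j then 2 * \<delta>\<^sup>2 else 0) else 0)"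
      by (intro sum.cong) (auto simp: axis_def power2_eq_square)
    then show ?thesis
      by (simp add: covariance_def mean integral_cross_measure)
  qed
  then show ?thesis
    by (simp add: vec_eq_iff covariance_matrix_def mat_def)
qed

text \<open>The determinant is (\<delta>^2 / n)^n.\<close>

lemma uncertainty_cross_measure:
  assumes "\<delta> \<noteq> 0"
  shows "uncertainty (cross_measure p \<delta>) (\<lambda>x. x) \<noteq> 0"
  using assms
  by (simp add: uncertainty_def covariance_matrix_cross_measure det_diagonal mat_def)

lemma AE_cross_measure:
  assumes "\<delta> > 0" and "\<And>x. norm (x - p) \<le> \<delta> \<Longrightarrow> P x"
  shows "AE x in cross_measure p \<delta>. P x"
proof -
  \<comment> \<open>\<open>AE_distr_iff\<close> asks for a measurable predicate, but
    \<open>P\<close> is arbitrary and will involve \<open>f\<close>. The closed ball is measurable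
    and contains all the points, and \<open>P\<close> follows from membership in it.\<close>
  have cball: "AE x in cross_measure p \<delta>. x \<in> cball p \<delta>"
    unfolding cross_measure_def
    using \<open>\<delta> > 0\<close> by (subst AE_distr_iff) (auto simp: cross_point_def dist_norm)
  show ?thesis
    using cball by eventually_elim (simp add: assms(2) dist_norm norm_minus_commute)
qed

text \<open>The relative error bound in \<open>small_support\<close> is the epsilon-delta form of
  differentiability at p, because \<open>f x - linearization f p x\<close> equals f x - f p - J (x -
  p).\<close>

lemma small_support_cross_measure:
  assumes "open D" "p \<in> D" "f differentiable (at p)" "\<epsilon> > 0"
  obtains \<delta> where "\<delta> > 0" "small_support \<epsilon> D f p (cross_measure p \<delta>)"
proof -
  from assms obtain r where r: "r > 0" "ball p r \<subseteq> D"
    by (meson open_contains_ball)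
  have "(f has_derivative (\<lambda>h. jacobian f (at p) *v h)) (at p)"
    using assms(3) jacobian_works by blast
  then obtain d where d: "d > 0"
      "\<And>y. norm (y - p) < d
        \<Longrightarrow> norm (f y - f p - jacobian f (at p) *v (y - p)) \<le> \<epsilon> * norm (y - p)"
    using \<open>\<epsilon> > 0\<close> unfolding has_derivative_at_alt by metis
  \<comment> \<open>Halving makes \<delta> strictly less than r and d: the points lie at distance
    exactly \<delta> from p, while the ball and the derivative bound are open conditions.\<close>
  define \<delta> where "\<delta> = min r d / 2"
  have \<delta>: "\<delta> > 0" "\<delta> < r" "\<delta> < d"
    using r d by (auto simp: \<delta>_def)
  have "small_support \<epsilon> D f p (cross_measure p \<delta>)"
    unfolding small_support_def
  proof (rule AE_cross_measure[OF \<delta>(1)], intro conjI)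
    fix x assume x: "norm (x - p) \<le> \<delta>"
    show "x \<in> D"
      using x \<delta> r by (auto simp: dist_norm norm_minus_commute)
    show "norm (f x - linearization f p x) \<le> \<epsilon> * norm (x - p)"
      using d(2)[of x] x \<delta>
      by (simp add: linearization_def matrix_vector_mult_diff_distrib algebra_simps)
  qed
  with \<delta>(1) show thesis
    by (rule that)
qed

theorem proposition4:
  fixes D :: "(real^'n) set" and f :: "real^'n \<Rightarrow> real^'n" and \<epsilon> :: real
  assumes "continuous_transformation D f"
    and "\<epsilon> > 0"
  shows "conserves_uncertainty \<epsilon> D f \<longleftrightarrow> (\<forall>p\<in>D. det (jacobian f (at p)) = 1)"
proof
  assume cons: "conserves_uncertainty \<epsilon> D f"
  show "\<forall>p\<in>D. det (jacobian f (at p)) = 1"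
  proof
    fix p assume p: "p \<in> D"
    with assms have f: "open D" "f differentiable (at p)" "det (jacobian f (at p)) > 0"
      by (auto simp: continuous_transformation_def)
    obtain \<delta> where \<delta>: "\<delta> > 0" "small_support \<epsilon> D f p (cross_measure p \<delta>)"
      using small_support_cross_measure f p assms(2) by metis
    let ?M = "cross_measure p \<delta>"
    have "uncertainty ?M (\<lambda>x. linearization f p x) = uncertainty ?M (\<lambda>x. x)"
      using cons p \<delta>(2) distribution_cross_measure by (auto simp: conserves_uncertainty_def)
    \<comment> \<open>The nonzero uncertainty of \<open>?M\<close> cancels from both sides of the
      scaling law.\<close>
    then have "(det (jacobian f (at p)))\<^sup>2 = 1"
      using uncertainty_linearization[OF distribution_cross_measure[of p \<delta>], of f p]
        uncertainty_cross_measure[of \<delta> p] \<delta>(1)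
      by simp
    with f(3) show "det (jacobian f (at p)) = 1"
      by (simp add: power2_eq_1_iff)
  qed
next
  assume "\<forall>p\<in>D. det (jacobian f (at p)) = 1"
  then show "conserves_uncertainty \<epsilon> D f"
    by (auto simp: conserves_uncertainty_def uncertainty_linearization)
qed

end
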